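(* Let $\alpha\in(0,1)$, let $\tau,h>0$ be arbitrary, let $a\in\mathbb{R}$, and put $a^+=\max(a,0)$, $a^-=\min(a,0)$. Let $(U_j^n)_{j\in\mathbb{Z},n\ge 0}$ be a real solution of the implicit upwind scheme for the linear advection equation $\partial_t^\alpha u+a\,\partial_x u=0$, i.e. for all $j\in\mathbb{Z}$, $n\ge 0$, $$D_t^\alpha U_j^{n+1}+\frac{a^+}{h}\big(U_j^{n+1}-U_{j-1}^{n+1}\big)+\frac{a^-}{h}\big(U_{j+1}^{n+1}-U_j^{n+1}\big)=0,$$ with $(U_j^n)_j\in\ell^2(\mathbb{Z})$ for every $n\ge 0$. Then the scheme is unconditionally $\ell^2$ stable: with $\lambda=|a|\,\Gamma(2-\alpha)\tau^\alpha/h$ and $\|U^n\|_{\ell^2}^2=\sum_j (U_j^n)^2$, for all $n\ge 1$, $$\|U^n\|_{\ell^2}^2+\sum_{j\in\mathbb{Z}}\sum_{k=0}^{n-1}c_k^n\big(U_j^n-U_j^k\big)^2+\lambda\sum_{j\in\mathbb{Z}}\big(U_j^n-U_{j-1}^n\big)^2\le\|U^0\|_{\ell^2}^2.$$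
   Context: $\partial_t^\alpha$ is the Caputo derivative, and the grid is uniform with time step $\tau$ and mesh size $h$. The discrete Caputo derivative is $$D_t^\alpha U_j^{n+1}=\frac{1}{\Gamma(2-\alpha)\tau^\alpha}\Big(U_j^{n+1}-\sum_{k=0}^n c_k^{n+1}U_j^k\Big),\qquad n\ge 0,$$ with $c_0^{n+1}=(n+1)^{1-\alpha}-n^{1-\alpha}$ and $c_k^{n+1}=2(n+1-k)^{1-\alpha}-(n+2-k)^{1-\alpha}-(n-k)^{1-\alpha}$ for $1\le k\le n$ (with $0^{1-\alpha}=0$). *)

theory Defs
  imports "HOL-Analysis.Analysis"
begin

text \<open>
  The weights \<open>c\<^sub>k\<^sup>n\<close> are written \<open>caputo_weight \<alpha> n k\<close> and matter only for \<open>k < n\<close>; the value at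
  time level \<open>0\<close> is a dummy. The convention \<open>0\<^sup>1\<^sup>-\<^sup>\<alpha> = 0\<close> is what \<open>powr\<close> gives.
\<close>

fun caputo_weight :: "real \<Rightarrow> nat \<Rightarrow> nat \<Rightarrow> real" where
  "caputo_weight \<alpha> 0 k = 0"
| "caputo_weight \<alpha> (Suc n) k =
     (if k = 0 then (real n + 1) powr (1 - \<alpha>) - real n powr (1 - \<alpha>)
      else 2 * (real n + 1 - real k) powr (1 - \<alpha>)
             - (real n + 2 - real k) powr (1 - \<alpha>)
             - (real n - real k) powr (1 - \<alpha>))"

text \<open>
  \<open>discrete_caputo \<alpha> \<tau> u n\<close> is the discrete derivative at time level \<open>n\<close>; it is meaningful for
  \<open>n \<ge> 1\<close> only.
\<close>

definition discrete_caputo :: "real \<Rightarrow> real \<Rightarrow> (nat \<Rightarrow> real) \<Rightarrow> nat \<Rightarrow> real" where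
  "discrete_caputo \<alpha> \<tau> u n =
     1 / (Gamma (2 - \<alpha>) * \<tau> powr \<alpha>) * (u n - (\<Sum>k<n. caputo_weight \<alpha> n k * u k))"

definition ell2 :: "(int \<Rightarrow> real) set" where
  "ell2 = {u. (\<lambda>j. (u j)\<^sup>2) summable_on UNIV}"

definition ell2_norm :: "(int \<Rightarrow> real) \<Rightarrow> real" where
  "ell2_norm u = sqrt (\<Sum>\<^sub>\<infinity>j. (u j)\<^sup>2)"

lemma ell2_norm_power2: "(ell2_norm u)\<^sup>2 = (\<Sum>\<^sub>\<infinity>j. (u j)\<^sup>2)"
  unfolding ell2_norm_def by (simp add: infsum_nonneg)

text \<open>
  An infinite sum \<open>\<Sum>\<^sub>\<infinity>\<close> is \<open>0\<close> by convention when it does not converge. The following facts show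
  that the sums over \<open>j\<close> of squared differences of sequences in \<^term>\<open>ell2\<close> do converge.
\<close>

lemma ell2_shift:
  assumes "u \<in> ell2"
  shows "(\<lambda>j. u (j + i)) \<in> ell2"
proof -
  have "bij_betw (\<lambda>j::int. j + i) UNIV UNIV"
    by (rule bij_betwI[where g = "\<lambda>j. j - i"]) auto
  from summable_on_reindex_bij_betw[OF this, of "\<lambda>j. (u j)\<^sup>2"] show ?thesis
    using assms by (simp add: ell2_def)
qed

lemma ell2_diff_summable:
  assumes "u \<in> ell2" and "v \<in> ell2"
  shows "(\<lambda>j. (u j - v j)\<^sup>2) summable_on UNIV"
proof (rule summable_on_comparison_test)
  show "(\<lambda>j. 2 * (u j)\<^sup>2 + 2 * (v j)\<^sup>2) summable_on UNIV"
    using assms unfolding ell2_def by (auto intro!: summable_on_add summable_on_cmult_right)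
  show "(u j - v j)\<^sup>2 \<le> 2 * (u j)\<^sup>2 + 2 * (v j)\<^sup>2" for j
    using zero_le_power2[of "u j + v j"] by (simp add: power2_eq_square algebra_simps)
qed auto

lemma ell2_upwind_diff_summable:
  assumes "u \<in> ell2"
  shows "(\<lambda>j. (u j - u (j - 1))\<^sup>2) summable_on UNIV"
  using ell2_diff_summable[OF assms ell2_shift[OF assms, of "-1"]] by simp

lemma ell2_memory_summable:
  assumes "\<And>n. U n \<in> ell2"
  shows "(\<lambda>j. \<Sum>k<n. caputo_weight \<alpha> n k * (U n j - U k j)\<^sup>2) summable_on UNIV"
proof -
  have "(\<lambda>j. \<Sum>k\<in>K. caputo_weight \<alpha> n k * (U n j - U k j)\<^sup>2) summable_on UNIV"
    if "finite K" for K
    using that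
    by (induction K)
       (auto intro!: summable_on_add summable_on_cmult_right ell2_diff_summable assms)
  then show ?thesis by simp
qed

end

theory Submission
  imports Defs
begin

text \<open>
  The weights at a time level are nonnegative and add up to \<open>1\<close>. Testing the scheme with
  \<open>2 U\<^sub>j\<^sup>n\<close> and using \<open>2 x (x - y) = x\<^sup>2 - y\<^sup>2 + (x - y)\<^sup>2\<close>, the flux telescopes up to its
  dissipation, and the left-hand side of the claim equals the weighted mean of the earlier
  squared norms. Strong induction on the time level bounds that mean by the initial one.
\<close>

text \<open>The mean value theorem asks for differentiability only between the endpoints. So x = 0
  is allowed, although the derivative of the power blows up there when \<beta> < 1; the most recent
  weight needs this case.\<close>

lemma powr_MVT:
  fixes x y \<beta> :: real
  assumes "0 \<le> x" "x < y" "0 < \<beta>"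
  obtains z where "x < z" "z < y" "y powr \<beta> - x powr \<beta> = (y - x) * (\<beta> * z powr (\<beta> - 1))"
proof -
  have der: "((\<lambda>x. x powr \<beta>) has_real_derivative \<beta> * z powr (\<beta> - 1)) (at z)" if "x < z" for z
    using that assms by (intro has_real_derivative_powr) linarith
  have "continuous_on {x..y} (\<lambda>x. x powr \<beta>)"
    using assms by (intro continuous_on_powr' continuous_intros) auto
  moreover have "(\<lambda>x. x powr \<beta>) differentiable (at z)" if "x < z" "z < y" for z
    using der[OF that(1)] by (auto simp: real_differentiable_def)
  ultimately obtain l z where z: "x < z" "z < y" "((\<lambda>x. x powr \<beta>) has_real_derivative l) (at z)"
      "y powr \<beta> - x powr \<beta> = (y - x) * l"
    using MVT[OF \<open>x < y\<close>] by blast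
  then show ?thesis
    using that[of z] DERIV_unique[OF z(3) der[OF z(1)]] by simp
qed

text \<open>The two unit increments on either side of x are \<beta> times a power with exponent
  \<beta> - 1 \<le> 0, taken at points y < x < z, so the later increment is the smaller one.\<close>

lemma powr_midpoint_concave:
  fixes x \<beta> :: real
  assumes "0 \<le> \<beta>" "\<beta> \<le> 1" "1 \<le> x"
  shows "(x + 1) powr \<beta> + (x - 1) powr \<beta> \<le> 2 * x powr \<beta>"
proof (cases "\<beta> = 0")
  \<comment> \<open>With \<open>0 powr 0 = 0\<close> the power jumps at 0 for this exponent, which
    puts it outside \<open>powr_MVT\<close>.\<close>
  case True
  then show ?thesis using assms by auto
next
  case False
  then have "0 < \<beta>" using assms by simp
  obtain y where y: "x - 1 < y" "y < x"
      "x powr \<beta> - (x - 1) powr \<beta> = (x - (x - 1)) * (\<beta> * y powr (\<beta> - 1))"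
    using powr_MVT[of "x - 1" x \<beta>] \<open>0 < \<beta>\<close> assms by auto
  obtain z where z: "x < z" "z < x + 1"
      "(x + 1) powr \<beta> - x powr \<beta> = (x + 1 - x) * (\<beta> * z powr (\<beta> - 1))"
    using powr_MVT[of x "x + 1" \<beta>] \<open>0 < \<beta>\<close> assms by auto
  have "z powr (\<beta> - 1) \<le> y powr (\<beta> - 1)"
    using y z assms by (intro powr_mono2') auto
  then have "\<beta> * z powr (\<beta> - 1) \<le> \<beta> * y powr (\<beta> - 1)"
    using assms by (simp add: mult_left_mono)
  with y z show ?thesis by simp
qed

lemma caputo_weight_nonneg:
  assumes "0 \<le> \<alpha>" "\<alpha> \<le> 1" "k < n"
  shows "0 \<le> caputo_weight \<alpha> n k"
proof (cases n)
  case (Suc m)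
  show ?thesis
  proof (cases "k = 0")
    case True
    then show ?thesis using Suc assms by (simp add: powr_mono2)
  next
    case False
    \<comment> \<open>For k \<ge> 1 the weight is minus the second difference of the power at m + 1
      - k, and k \<le> m keeps this point at 1 or above.\<close>
    then show ?thesis
      using powr_midpoint_concave[of "1 - \<alpha>" "real m + 1 - real k"] Suc assms
      by (simp add: algebra_simps)
  qed
qed simp

lemma sum_caputo_weight:
  assumes "\<alpha> < 1" "1 \<le> n"
  shows "(\<Sum>k<n. caputo_weight \<alpha> n k) = 1"
proof -
  obtain m where m: "n = Suc m" using assms by (cases n) auto
  \<comment> \<open>Weight 0 is \<open>b 0\<close> and each later weight is an increment of
    \<open>b\<close>. The sum collapses to \<open>b m\<close>, which is 1 because
    \<open>0 powr (1 - \<alpha>) = 0\<close>.\<close>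
  define b where "b k = (real m + 1 - real k) powr (1 - \<alpha>) - (real m - real k) powr (1 - \<alpha>)" for k
  have "(\<Sum>k<n. caputo_weight \<alpha> n k) = b 0 + (\<Sum>k<m. caputo_weight \<alpha> n (Suc k))"
    unfolding m by (subst sum.lessThan_Suc_shift) (simp add: b_def)
  also have "(\<Sum>k<m. caputo_weight \<alpha> n (Suc k)) = (\<Sum>k<m. b (Suc k) - b k)"
    by (simp add: m b_def algebra_simps)
  also have "\<dots> = b m - b 0" by (rule sum_lessThan_telescope)
  finally show ?thesis by (simp add: b_def)
qed

lemma has_sum_shift_int:
  assumes "(f has_sum s) UNIV"
  shows "((\<lambda>j. f (j + i)) has_sum s) (UNIV :: int set)"
proof -
  have "bij_betw (\<lambda>j::int. j + i) UNIV UNIV"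
    by (rule bij_betwI[where g = "\<lambda>j. j - i"]) auto
  from has_sum_reindex_bij_betw[OF this] assms show ?thesis by blast
qed

lemma has_sum_weighted_sum:
  fixes f :: "'k \<Rightarrow> 'a \<Rightarrow> real"
  assumes "finite K" "\<And>k. k \<in> K \<Longrightarrow> (f k has_sum s k) A"
  shows "((\<lambda>x. \<Sum>k\<in>K. w k * f k x) has_sum (\<Sum>k\<in>K. w k * s k)) A"
  using assms by (induction K) (auto intro!: has_sum_add has_sum_cmult_right)

text \<open>Since the weights add up to 1, x minus the mean of the y k is the mean of x - y k. The
  identity is then the weighted mean of 2 x (x - y) = x^2 - y^2 + (x - y)^2.\<close>

lemma weighted_square_identity:
  fixes x :: real
  assumes "(\<Sum>k\<in>K. w k) = 1"
  shows "2 * x * (x - (\<Sum>k\<in>K. w k * y k))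
    = x\<^sup>2 + (\<Sum>k\<in>K. w k * (x - y k)\<^sup>2) - (\<Sum>k\<in>K. w k * (y k)\<^sup>2)"
proof -
  have "(\<Sum>k\<in>K. w k * (x - y k)\<^sup>2)
      = (\<Sum>k\<in>K. x\<^sup>2 * w k - 2 * x * (w k * y k) + w k * (y k)\<^sup>2)"
    by (simp add: power2_eq_square algebra_simps)
  also have "\<dots> = x\<^sup>2 * (\<Sum>k\<in>K. w k) - 2 * x * (\<Sum>k\<in>K. w k * y k) + (\<Sum>k\<in>K. w k * (y k)\<^sup>2)"
    by (simp only: sum.distrib sum_subtractf sum_distrib_left)
  finally show ?thesis using assms by (simp add: power2_eq_square algebra_simps)
qed

text \<open>One time level in isolation. It is an equality because only the total of the weights
  enters; their signs are left to the induction.\<close>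

theorem upwind_energy_identity:
  fixes \<alpha> \<tau> h a :: real and U :: "nat \<Rightarrow> int \<Rightarrow> real"
  assumes "\<alpha> < 1" "0 < \<tau>" "0 < h" "1 \<le> n"
    and scheme: "\<And>j. discrete_caputo \<alpha> \<tau> (\<lambda>m. U m j) n
        + max a 0 / h * (U n j - U n (j - 1)) + min a 0 / h * (U n (j + 1) - U n j) = 0"
    and ell2: "\<And>m. U m \<in> ell2"
  shows "(ell2_norm (U n))\<^sup>2
      + (\<Sum>\<^sub>\<infinity>j. \<Sum>k<n. caputo_weight \<alpha> n k * (U n j - U k j)\<^sup>2)
      + (\<bar>a\<bar> * Gamma (2 - \<alpha>) * \<tau> powr \<alpha> / h) * (\<Sum>\<^sub>\<infinity>j. (U n j - U n (j - 1))\<^sup>2)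
      = (\<Sum>k<n. caputo_weight \<alpha> n k * (ell2_norm (U k))\<^sup>2)"
proof -
  define G where "G = Gamma (2 - \<alpha>) * \<tau> powr \<alpha>"
  have "0 < G" using assms by (simp add: G_def)
  define nu where "nu = \<bar>a\<bar> * G / h"
  define w where "w = caputo_weight \<alpha> n"
  \<comment> \<open>The offset of the upwind neighbour: one of the two fluxes vanishes, and the
    other is |a|/h times the difference to this neighbour for either sign of a.\<close>
  define i :: int where "i = (if 0 \<le> a then -1 else 1)"
  define E where "E = (\<Sum>\<^sub>\<infinity>j. (U n j - U n (j - 1))\<^sup>2)"
  have norm: "((\<lambda>j. (U k j)\<^sup>2) has_sum (ell2_norm (U k))\<^sup>2) UNIV" for k
    using ell2[of k] by (simp add: ell2_norm_power2 ell2_def)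
  have upwind: "((\<lambda>j. (U n j - U n (j - 1))\<^sup>2) has_sum E) UNIV"
    unfolding E_def using ell2_upwind_diff_summable[OF ell2] by (rule has_sum_infsum)
  \<comment> \<open>For i = 1 these are the backward differences shifted by one index, up to sign,
    so the sum is the same \<open>E\<close>.\<close>
  have diss: "((\<lambda>j. (U n j - U n (j + i))\<^sup>2) has_sum E) UNIV"
    using upwind has_sum_shift_int[OF upwind, of 1]
    by (auto simp: i_def power2_commute)
  have memory: "((\<lambda>j. \<Sum>k<n. w k * (U n j - U k j)\<^sup>2)
      has_sum (\<Sum>\<^sub>\<infinity>j. \<Sum>k<n. w k * (U n j - U k j)\<^sup>2)) UNIV"
    unfolding w_def using ell2_memory_summable[OF ell2] by (rule has_sum_infsum)
  have pointwise: "(U n j)\<^sup>2 + (\<Sum>k<n. w k * (U n j - U k j)\<^sup>2)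
      + nu * ((U n j)\<^sup>2 - (U n (j + i))\<^sup>2 + (U n j - U n (j + i))\<^sup>2)
      = (\<Sum>k<n. w k * (U k j)\<^sup>2)" for j
  proof -
    have flux: "max a 0 / h * (U n j - U n (j - 1)) + min a 0 / h * (U n (j + 1) - U n j)
        = \<bar>a\<bar> / h * (U n j - U n (j + i))"
      by (simp add: i_def max_def min_def field_simps)
    have "1 / G * (U n j - (\<Sum>k<n. w k * U k j)) + \<bar>a\<bar> / h * (U n j - U n (j + i)) = 0"
      using scheme[of j] flux unfolding discrete_caputo_def w_def G_def by linarith
    then have step: "U n j - (\<Sum>k<n. w k * U k j) = - nu * (U n j - U n (j + i))"
      using \<open>0 < G\<close> \<open>0 < h\<close> unfolding nu_def by (simp add: field_simps)
    have "(\<Sum>k<n. w k) = 1"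
      using assms unfolding w_def by (intro sum_caputo_weight)
    from weighted_square_identity[OF this, of "U n j" "\<lambda>k. U k j"]
    have "(U n j)\<^sup>2 + (\<Sum>k<n. w k * (U n j - U k j)\<^sup>2) - (\<Sum>k<n. w k * (U k j)\<^sup>2)
        = 2 * U n j * (- nu * (U n j - U n (j + i)))"
      unfolding step by simp
    also have "\<dots> = - nu * ((U n j)\<^sup>2 - (U n (j + i))\<^sup>2 + (U n j - U n (j + i))\<^sup>2)"
      by (simp add: power2_eq_square algebra_simps)
    finally show ?thesis by simp
  qed
  \<comment> \<open>A convergent sum over all integers is invariant under shifts, so no boundary
    term remains.\<close>
  have telescope: "((\<lambda>j. (U n j)\<^sup>2 - (U n (j + i))\<^sup>2) has_sum 0) UNIV"
    using has_sum_add[OF norm[of n] has_sum_cmult_right[OF has_sum_shift_int[OF norm[of n], of i], of "-1"]]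
    by simp
  \<comment> \<open>The right side of \<open>pointwise\<close> is summed over j in two ways, and
    uniqueness of the sum gives the identity.\<close>
  have "((\<lambda>j. \<Sum>k<n. w k * (U k j)\<^sup>2) has_sum
      (ell2_norm (U n))\<^sup>2 + (\<Sum>\<^sub>\<infinity>j. \<Sum>k<n. w k * (U n j - U k j)\<^sup>2) + nu * (0 + E)) UNIV"
    unfolding pointwise[symmetric]
    by (intro has_sum_add has_sum_cmult_right norm memory diss telescope)
  moreover have "((\<lambda>j. \<Sum>k<n. w k * (U k j)\<^sup>2) has_sum (\<Sum>k<n. w k * (ell2_norm (U k))\<^sup>2)) UNIV"
    using norm by (intro has_sum_weighted_sum) auto
  ultimately show ?thesis
    by (auto dest: has_sum_unique simp: w_def E_def nu_def G_def mult.assoc)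
qed

theorem mainTheorem7:
  fixes \<alpha> \<tau> h a :: real and U :: "nat \<Rightarrow> int \<Rightarrow> real" and n :: nat
  assumes "0 < \<alpha>" and "\<alpha> < 1" and "\<tau> > 0" and "h > 0"
    and scheme: "\<And>(j::int) (n::nat).
      discrete_caputo \<alpha> \<tau> (\<lambda>m. U m j) (n + 1)
        + max a 0 / h * (U (n + 1) j - U (n + 1) (j - 1))
        + min a 0 / h * (U (n + 1) (j + 1) - U (n + 1) j) = 0"
    and "\<And>n. U n \<in> ell2"
    and "n \<ge> 1"
  shows "(ell2_norm (U n))\<^sup>2
      + (\<Sum>\<^sub>\<infinity>j. \<Sum>k<n. caputo_weight \<alpha> n k * (U n j - U k j)\<^sup>2)
      + (\<bar>a\<bar> * Gamma (2 - \<alpha>) * \<tau> powr \<alpha> / h) * (\<Sum>\<^sub>\<infinity>j. (U n j - U n (j - 1))\<^sup>2)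
      \<le> (ell2_norm (U 0))\<^sup>2"
  using \<open>n \<ge> 1\<close>
proof (induction n rule: less_induct)
  case (less n)
  let ?energy = "\<lambda>n. (ell2_norm (U n))\<^sup>2
      + (\<Sum>\<^sub>\<infinity>j. \<Sum>k<n. caputo_weight \<alpha> n k * (U n j - U k j)\<^sup>2)
      + (\<bar>a\<bar> * Gamma (2 - \<alpha>) * \<tau> powr \<alpha> / h) * (\<Sum>\<^sub>\<infinity>j. (U n j - U n (j - 1))\<^sup>2)"
  have "0 < Gamma (2 - \<alpha>)" using \<open>\<alpha> < 1\<close> by simp
  have weight_nonneg: "0 \<le> caputo_weight \<alpha> m k" if "k < m" for k m
    using assms(1,2) that by (intro caputo_weight_nonneg) auto
  have norm_le: "(ell2_norm (U k))\<^sup>2 \<le> (ell2_norm (U 0))\<^sup>2" if "k < n" for k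
  proof (cases "k = 0")
    \<comment> \<open>The induction hypothesis starts at level 1. Dropping its nonnegative memory
      and dissipation terms leaves the bound on the norm.\<close>
    case False
    have "0 \<le> (\<Sum>\<^sub>\<infinity>j. \<Sum>l<k. caputo_weight \<alpha> k l * (U k j - U l j)\<^sup>2)"
      by (intro infsum_nonneg sum_nonneg mult_nonneg_nonneg weight_nonneg) auto
    moreover have "0 \<le> (\<bar>a\<bar> * Gamma (2 - \<alpha>) * \<tau> powr \<alpha> / h) * (\<Sum>\<^sub>\<infinity>j. (U k j - U k (j - 1))\<^sup>2)"
      using \<open>0 < h\<close> \<open>0 < Gamma (2 - \<alpha>)\<close>
      by (intro mult_nonneg_nonneg divide_nonneg_pos infsum_nonneg) auto
    moreover have "?energy k \<le> (ell2_norm (U 0))\<^sup>2"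
      using less.IH[of k] that False by simp
    ultimately show ?thesis by linarith
  qed simp
  \<comment> \<open>The scheme is indexed by the preceding level, hence n - 1.\<close>
  have "?energy n = (\<Sum>k<n. caputo_weight \<alpha> n k * (ell2_norm (U k))\<^sup>2)"
    using scheme[of _ "n - 1"] assms less.prems by (intro upwind_energy_identity) auto
  also have "\<dots> \<le> (\<Sum>k<n. caputo_weight \<alpha> n k * (ell2_norm (U 0))\<^sup>2)"
    using norm_le weight_nonneg by (intro sum_mono mult_left_mono) auto
  also have "\<dots> = (ell2_norm (U 0))\<^sup>2"
    using sum_caputo_weight[of \<alpha> n] \<open>\<alpha> < 1\<close> less.prems
    by (simp flip: sum_distrib_right)
  finally show ?case .
qed

end
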